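(* Let $m\ge 1$ be an integer, $I=\{1,\ldots,m\}$, let $(T_i)_{i\in I}$ be a family of firmly nonexpansive mappings $T_i\colon X\to X$, and let $(\lambda_i)_{i\in I}$ be a family of strictly positive real numbers such that $\sum_{i\in I}\lambda_i=1$. Suppose that $T_i$ is asymptotically regular for every $i\in I$. Then $\sum_{i\in I}\lambda_iT_i$ is also asymptotically regular.
   Context: $X$ is a real Euclidean space (finite-dimensional real inner product space) with inner product $\langle\cdot,\cdot\rangle$ and induced norm $\|\cdot\|$. A mapping $T\colon X\to X$ is firmly nonexpansive if $\langle x-y,Tx-Ty\rangle\ge\|Tx-Ty\|^2$ for all $x,y\in X$. A firmly nonexpansive mapping $T$ is asymptotically regular if there exists a sequence $(x_n)_{n\in\mathbb N}$ in $X$ such that $x_n-Tx_n\to0$; equivalently, if $0\in\overline{\operatorname{ran}(\operatorname{Id}-T)}$, where $\operatorname{Id}$ is the identity on $X$, $\operatorname{ran}$ denotes range and the bar denotes closure. *)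

theory Defs
  imports "HOL-Analysis.Analysis"
begin

definition firmly_nonexpansive :: "('a::real_inner \<Rightarrow> 'a) \<Rightarrow> bool" where
  "firmly_nonexpansive T \<longleftrightarrow> (\<forall>x y. (x - y) \<bullet> (T x - T y) \<ge> (norm (T x - T y))\<^sup>2)"

text \<open>Asymptotic regularity is a notion for firmly nonexpansive mappings only, so firm
  nonexpansiveness is part of the predicate; claiming that a mapping is asymptotically regular
  therefore includes the claim that it is firmly nonexpansive.\<close>

definition asymptotically_regular :: "('a::real_inner \<Rightarrow> 'a) \<Rightarrow> bool" where
  "asymptotically_regular T \<longleftrightarrow>
     firmly_nonexpansive T \<and> (\<exists>x :: nat \<Rightarrow> 'a. (\<lambda>n. x n - T (x n)) \<longlonglongrightarrow> 0)"

text \<open>Finite dimensionality is stated as a property of a \<open>real_inner\<close> type instead of by the class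
  \<open>euclidean_space\<close>, because the latter excludes the zero-dimensional space.\<close>

definition finite_dimensional_space :: "'a::real_vector itself \<Rightarrow> bool" where
  "finite_dimensional_space _ \<longleftrightarrow> (\<exists>B :: 'a set. finite B \<and> span B = UNIV)"

end

theory Submission
  imports Defs
begin

text \<open>
  Write \<open>F\<^sub>i = Id - T\<^sub>i\<close> and \<open>F = \<Sum>i. \<lambda>\<^sub>i F\<^sub>i = Id - \<Sum>i. \<lambda>\<^sub>i T\<^sub>i\<close>; the claim is that \<open>F\<close> takes arbitrarily
  small values if every \<open>F\<^sub>i\<close> does. This is a Brezis--Haraux phenomenon: ranges of monotone
  operators add up as expected as soon as the graph of each summand is bounded below in the right
  way. The needed bound comes from firm nonexpansiveness of \<open>F\<^sub>i\<close>. For a fixed \<open>y\<close>, the quadratic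
  term in \<open>\<langle>x - y, F\<^sub>i x - F\<^sub>i y\<rangle> \<ge> \<parallel>F\<^sub>i x - F\<^sub>i y\<parallel>\<^sup>2\<close> absorbs \<open>\<langle>y, F\<^sub>i x - F\<^sub>i y\<rangle>\<close>, which leaves
  \<open>\<langle>x, F\<^sub>i x\<rangle> \<ge> - \<parallel>F\<^sub>i y\<parallel> \<parallel>x\<parallel> - \<parallel>y\<parallel>\<^sup>2 / 4\<close> for all \<open>x\<close>
  (\<open>firmly_nonexpansive_inner_lower_bound\<close>). Picking for each \<open>i\<close> a point \<open>y\<^sub>i\<close> with
  \<open>\<parallel>F\<^sub>i y\<^sub>i\<parallel> \<le> \<delta>\<close> and averaging gives \<open>\<langle>x, F x\<rangle> \<ge> - \<delta> \<parallel>x\<parallel> - C\<close> with \<open>C\<close> independent of \<open>x\<close>.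

  Now regularize: for \<open>\<epsilon> > 0\<close> the equation \<open>F x + \<epsilon> x = 0\<close> says that \<open>x\<close> is a fixed point of the
  contraction \<open>(Id - F) / (1 + \<epsilon>)\<close>, so it has solutions up to an arbitrarily small error,
  in particular up to \<open>\<delta>\<close> (\<open>firmly_nonexpansive_regularized_zero\<close>). At such a solution the bound reads
  \<open>\<epsilon> \<parallel>x\<parallel>\<^sup>2 \<le> 2 \<delta> \<parallel>x\<parallel> + C\<close>. Multiplied by \<open>\<epsilon>\<close>, where \<open>\<epsilon>\<close> is chosen after \<open>C\<close> such that
  \<open>\<epsilon> C \<le> \<delta>\<^sup>2\<close>, this is a quadratic inequality for \<open>\<epsilon> \<parallel>x\<parallel>\<close> that forces \<open>\<epsilon> \<parallel>x\<parallel> \<le> 3 \<delta>\<close>, and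
  \<open>F x\<close> is as small as \<open>\<epsilon> x\<close> up to the error. Although \<open>x\<close> itself may run off to infinity as
  \<open>\<epsilon>\<close> tends to \<open>0\<close>, \<open>\<epsilon> x\<close> tends to \<open>0\<close>.
\<close>

lemma firmly_nonexpansiveD:
  "firmly_nonexpansive T \<Longrightarrow> (norm (T x - T y))\<^sup>2 \<le> (x - y) \<bullet> (T x - T y)"
  by (simp add: firmly_nonexpansive_def)

lemma firmly_nonexpansive_imp_nonexpansive:
  assumes "firmly_nonexpansive T"
  shows "norm (T x - T y) \<le> norm (x - y)"
proof -
  have "norm (T x - T y) * norm (T x - T y) \<le> norm (x - y) * norm (T x - T y)"
    using firmly_nonexpansiveD[OF assms, of x y] norm_cauchy_schwarz[of "x - y" "T x - T y"]
    by (simp add: power2_eq_square)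
  then show ?thesis
    by (cases "T x = T y") auto
qed

text \<open>The defining inequality is invariant under exchanging \<open>u = T x - T y\<close> and
  \<open>v = x - y - u\<close>: it says \<open>\<langle>u, v\<rangle> \<ge> 0\<close>.\<close>

lemma firmly_nonexpansive_complement:
  assumes "firmly_nonexpansive T"
  shows "firmly_nonexpansive (\<lambda>x. x - T x)"
  unfolding firmly_nonexpansive_def
proof (intro allI)
  fix x y
  define u where "u = T x - T y"
  define d where "d = x - y"
  have eq: "x - T x - (y - T y) = d - u"
    by (simp add: u_def d_def)
  have "(norm u)\<^sup>2 \<le> d \<bullet> u"
    using firmly_nonexpansiveD[OF assms, of x y] by (simp add: u_def d_def)
  then have "(norm (d - u))\<^sup>2 \<le> d \<bullet> (d - u)"
    by (simp add: power2_norm_eq_inner algebra_simps inner_commute)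
  then show "(norm (x - T x - (y - T y)))\<^sup>2 \<le> (x - y) \<bullet> (x - T x - (y - T y))"
    unfolding eq d_def[symmetric] .
qed

text \<open>The difference of the two sides is the variance \<open>\<Sum>i. \<lambda>\<^sub>i \<parallel>v\<^sub>i - s\<parallel>\<^sup>2\<close> of the vectors \<open>v\<^sub>i\<close>
  around their mean \<open>s\<close>.\<close>

lemma norm_convex_combination_squared_le:
  fixes v :: "'i \<Rightarrow> 'a::real_inner"
  assumes "\<And>i. i \<in> I \<Longrightarrow> 0 \<le> l i" and "sum l I = 1"
  shows "(norm (\<Sum>i\<in>I. l i *\<^sub>R v i))\<^sup>2 \<le> (\<Sum>i\<in>I. l i * (norm (v i))\<^sup>2)"
proof -
  define s where "s = (\<Sum>i\<in>I. l i *\<^sub>R v i)"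
  have mean: "(\<Sum>i\<in>I. l i * (s \<bullet> v i)) = s \<bullet> s"
    unfolding s_def by (simp add: inner_sum_right)
  have "0 \<le> (\<Sum>i\<in>I. l i * (norm (v i - s))\<^sup>2)"
    by (intro sum_nonneg mult_nonneg_nonneg assms) auto
  also have "\<dots> = (\<Sum>i\<in>I. l i * (norm (v i))\<^sup>2 - 2 * (l i * (s \<bullet> v i)) + l i * (s \<bullet> s))"
    by (intro sum.cong refl)
      (simp add: power2_norm_eq_inner inner_diff_left inner_diff_right inner_commute algebra_simps)
  also have "\<dots> = (\<Sum>i\<in>I. l i * (norm (v i))\<^sup>2) - 2 * (s \<bullet> s) + sum l I * (s \<bullet> s)"
    by (simp only: sum.distrib sum_subtractf mean flip: sum_distrib_left sum_distrib_right)
  finally show ?thesis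
    by (simp add: assms(2) power2_norm_eq_inner flip: s_def)
qed

lemma firmly_nonexpansive_convex_combination:
  assumes firm: "\<And>i. i \<in> I \<Longrightarrow> firmly_nonexpansive (T i)"
    and l: "\<And>i. i \<in> I \<Longrightarrow> 0 \<le> l i" "sum l I = 1"
  shows "firmly_nonexpansive (\<lambda>x. \<Sum>i\<in>I. l i *\<^sub>R T i x)"
  unfolding firmly_nonexpansive_def
proof (intro allI)
  fix x y
  have eq: "(\<Sum>i\<in>I. l i *\<^sub>R T i x) - (\<Sum>i\<in>I. l i *\<^sub>R T i y) = (\<Sum>i\<in>I. l i *\<^sub>R (T i x - T i y))"
    by (simp add: sum_subtractf scaleR_diff_right)
  have "(norm (\<Sum>i\<in>I. l i *\<^sub>R (T i x - T i y)))\<^sup>2 \<le> (\<Sum>i\<in>I. l i * (norm (T i x - T i y))\<^sup>2)"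
    using l by (rule norm_convex_combination_squared_le)
  also have "\<dots> \<le> (\<Sum>i\<in>I. l i * ((x - y) \<bullet> (T i x - T i y)))"
    by (intro sum_mono mult_left_mono firmly_nonexpansiveD firm l)
  also have "\<dots> = (x - y) \<bullet> (\<Sum>i\<in>I. l i *\<^sub>R (T i x - T i y))"
    by (simp add: inner_sum_right)
  finally show "(norm ((\<Sum>i\<in>I. l i *\<^sub>R T i x) - (\<Sum>i\<in>I. l i *\<^sub>R T i y)))\<^sup>2
      \<le> (x - y) \<bullet> ((\<Sum>i\<in>I. l i *\<^sub>R T i x) - (\<Sum>i\<in>I. l i *\<^sub>R T i y))"
    unfolding eq .
qed

text \<open>Firm nonexpansiveness makes \<open>F\<close> more than monotone: \<open>\<langle>x, F x\<rangle>\<close> has a lower bound in which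
  only the slope \<open>\<parallel>F y\<parallel>\<close> in \<open>\<parallel>x\<parallel>\<close> matters, and this slope is small if \<open>F y\<close> is. Mere monotonicity
  would leave a term \<open>\<parallel>y\<parallel> \<parallel>F x\<parallel>\<close>; here it is absorbed by \<open>\<parallel>F x - F y\<parallel>\<^sup>2\<close>.\<close>

lemma firmly_nonexpansive_inner_lower_bound:
  assumes "firmly_nonexpansive F"
  shows "- (x \<bullet> F x) \<le> norm (F y) * norm x + (norm y)\<^sup>2 / 4"
proof -
  define u where "u = F x - F y"
  have "(norm u)\<^sup>2 \<le> x \<bullet> F x - x \<bullet> F y - y \<bullet> u"
    using firmly_nonexpansiveD[OF assms, of x y] by (simp add: u_def algebra_simps)
  moreover have "- (x \<bullet> F y) \<le> norm (F y) * norm x"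
    using Cauchy_Schwarz_ineq2[of x "F y"] by (simp add: mult.commute abs_le_iff)
  moreover have "- (y \<bullet> u) \<le> (norm u)\<^sup>2 + (norm y)\<^sup>2 / 4"
  proof -
    have "0 \<le> (norm (u + (1/2) *\<^sub>R y))\<^sup>2"
      by simp
    also have "\<dots> = (norm u)\<^sup>2 + y \<bullet> u + (norm y)\<^sup>2 / 4"
      by (simp add: power2_norm_eq_inner inner_add_left inner_add_right inner_commute)
    finally show ?thesis by simp
  qed
  ultimately show ?thesis by linarith
qed

text \<open>The displacements of the iterates of a contraction decay geometrically, so late iterates
  are almost fixed.\<close>

lemma contraction_approximate_fixed_point:
  fixes S :: "'a::metric_space \<Rightarrow> 'a"
  assumes c: "0 \<le> c" "c < 1" and S: "\<And>x y. dist (S x) (S y) \<le> c * dist x y" and "0 < e"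
  shows "\<exists>x. dist (S x) x < e"
proof -
  fix x0 :: 'a
  have decay: "dist ((S ^^ Suc n) x0) ((S ^^ n) x0) \<le> c ^ n * dist (S x0) x0" for n
  proof (induction n)
    case (Suc n)
    have "dist ((S ^^ Suc (Suc n)) x0) ((S ^^ Suc n) x0)
        \<le> c * dist ((S ^^ Suc n) x0) ((S ^^ n) x0)"
      using S by simp
    also have "\<dots> \<le> c * (c ^ n * dist (S x0) x0)"
      using Suc c by (intro mult_left_mono)
    finally show ?case by (simp add: mult.assoc)
  qed simp
  have "(\<lambda>n. c ^ n * dist (S x0) x0) \<longlonglongrightarrow> 0"
    using c by (intro tendsto_mult_left_zero LIMSEQ_power_zero) auto
  then have "\<forall>\<^sub>F n in sequentially. c ^ n * dist (S x0) x0 < e"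
    using \<open>0 < e\<close> by (rule order_tendstoD)
  then obtain n where "c ^ n * dist (S x0) x0 < e"
    by (auto simp: eventually_sequentially)
  with decay[of n] have "dist (S ((S ^^ n) x0)) ((S ^^ n) x0) < e"
    by simp
  then show ?thesis ..
qed

lemma firmly_nonexpansive_regularized_zero:
  fixes F :: "'a::real_inner \<Rightarrow> 'a"
  assumes F: "firmly_nonexpansive F" and "0 < \<epsilon>" and "0 < \<delta>"
  shows "\<exists>x. norm (F x + \<epsilon> *\<^sub>R x) < \<delta>"
proof -
  define c where "c = 1 / (1 + \<epsilon>)"
  define S where "S = (\<lambda>x. c *\<^sub>R (x - F x))"
  have c: "0 < c" "c < 1" "c * (1 + \<epsilon>) = 1"
    using \<open>0 < \<epsilon>\<close> by (auto simp: c_def)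
  have "dist (S x) (S y) \<le> c * dist x y" for x y
  proof -
    have "dist (S x) (S y) = c * norm (x - F x - (y - F y))"
      using c(1) unfolding S_def dist_norm by (simp flip: scaleR_diff_right)
    also have "\<dots> \<le> c * norm (x - y)"
      using c(1) firmly_nonexpansive_imp_nonexpansive[OF firmly_nonexpansive_complement[OF F]]
      by (intro mult_left_mono) auto
    finally show ?thesis by (simp add: dist_norm)
  qed
  moreover have "0 < c * \<delta>"
    using c \<open>0 < \<delta>\<close> by simp
  ultimately obtain x where x: "dist (S x) x < c * \<delta>"
    using contraction_approximate_fixed_point[of c S "c * \<delta>"] c by auto
  have "x - S x = (c * (1 + \<epsilon>)) *\<^sub>R x - S x"
    using c(3) by simp
  also have "\<dots> = c *\<^sub>R (F x + \<epsilon> *\<^sub>R x)"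
    by (simp add: S_def algebra_simps)
  finally have "norm (x - S x) = c * norm (F x + \<epsilon> *\<^sub>R x)"
    using c(1) by simp
  then have "dist (S x) x = c * norm (F x + \<epsilon> *\<^sub>R x)"
    by (simp only: dist_norm norm_minus_commute[of "S x"])
  with x c(1) show ?thesis
    by auto
qed

text \<open>The order of the choices is what makes this work: the points \<open>y i\<close> depend on \<open>\<delta>\<close> and may be
  far away, but they enter only through the constant \<open>C\<close>, and the regularization parameter \<open>\<epsilon>\<close> is
  chosen last, so small that it makes \<open>C\<close> harmless.\<close>

lemma convex_combination_small_values:
  fixes F :: "'i \<Rightarrow> 'a::real_inner \<Rightarrow> 'a"
  assumes firm: "\<And>i. i \<in> I \<Longrightarrow> firmly_nonexpansive (F i)"
    and l: "\<And>i. i \<in> I \<Longrightarrow> 0 \<le> l i" "sum l I = 1"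
    and small: "\<And>i e. i \<in> I \<Longrightarrow> 0 < e \<Longrightarrow> \<exists>y. norm (F i y) < e"
    and "0 < e"
  shows "\<exists>x. norm (\<Sum>i\<in>I. l i *\<^sub>R F i x) < e"
proof -
  (* The final estimate is at most 3 \<delta> for the regularizing term plus \<delta> for the residual r. *)
  define \<delta> where "\<delta> = e / 4"
  have \<delta>: "0 < \<delta>"
    using \<open>0 < e\<close> by (simp add: \<delta>_def)
  define G where "G = (\<lambda>x. \<Sum>i\<in>I. l i *\<^sub>R F i x)"
  have "\<forall>i. \<exists>y. i \<in> I \<longrightarrow> norm (F i y) < \<delta>"
    using small \<delta> by blast
  then obtain y where y: "\<And>i. i \<in> I \<Longrightarrow> norm (F i (y i)) < \<delta>"
    by metis
  define C where "C = (\<Sum>i\<in>I. l i * ((norm (y i))\<^sup>2 / 4))"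
  have C: "0 \<le> C"
    unfolding C_def by (intro sum_nonneg mult_nonneg_nonneg l) auto
  have lower: "- (x \<bullet> G x) \<le> \<delta> * norm x + C" for x
  proof -
    have "- (x \<bullet> G x) = (\<Sum>i\<in>I. l i * - (x \<bullet> F i x))"
      by (simp add: G_def inner_sum_right sum_negf)
    also have "\<dots> \<le> (\<Sum>i\<in>I. l i * (\<delta> * norm x + (norm (y i))\<^sup>2 / 4))"
    proof (intro sum_mono mult_left_mono l)
      fix i assume i: "i \<in> I"
      have "norm (F i (y i)) * norm x \<le> \<delta> * norm x"
        using y[OF i] by (intro mult_right_mono) auto
      with firmly_nonexpansive_inner_lower_bound[OF firm[OF i], of x "y i"]
      show "- (x \<bullet> F i x) \<le> \<delta> * norm x + (norm (y i))\<^sup>2 / 4"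
        by linarith
    qed
    also have "\<dots> = sum l I * (\<delta> * norm x) + C"
      by (simp only: distrib_left sum.distrib sum_distrib_right C_def)
    finally show ?thesis by (simp add: l)
  qed
  define \<epsilon> where "\<epsilon> = \<delta>\<^sup>2 / (C + 1)"
  have \<epsilon>: "0 < \<epsilon>" "\<epsilon> * C \<le> \<delta>\<^sup>2"
    using \<delta> C by (auto simp: \<epsilon>_def field_simps)
  have "firmly_nonexpansive G"
    unfolding G_def using firm l by (rule firmly_nonexpansive_convex_combination)
  then obtain x where x: "norm (G x + \<epsilon> *\<^sub>R x) < \<delta>"
    using firmly_nonexpansive_regularized_zero \<epsilon>(1) \<delta> by blast
  define r where "r = G x + \<epsilon> *\<^sub>R x"
  (* Only the product p has to be controlled; norm x need not stay bounded as \<epsilon> shrinks. *)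
  define p where "p = \<epsilon> * norm x"
  have "\<epsilon> * (norm x)\<^sup>2 = x \<bullet> r - x \<bullet> G x"
    by (simp add: r_def inner_add_right power2_norm_eq_inner)
  also have "\<dots> \<le> 2 * \<delta> * norm x + C"
  proof -
    have "x \<bullet> r \<le> norm x * norm r"
      by (rule norm_cauchy_schwarz)
    also have "\<dots> \<le> norm x * \<delta>"
      using x by (intro mult_left_mono) (auto simp: r_def)
    finally show ?thesis
      using lower[of x] by (simp add: algebra_simps)
  qed
  finally have "\<epsilon> * (\<epsilon> * (norm x)\<^sup>2) \<le> \<epsilon> * (2 * \<delta> * norm x + C)"
    using \<epsilon>(1) by (intro mult_left_mono) auto
  then have "p\<^sup>2 \<le> 2 * \<delta> * p + \<delta>\<^sup>2"
    using \<epsilon>(2) by (simp add: p_def power2_eq_square algebra_simps)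
  then have "(p - \<delta>)\<^sup>2 \<le> (2 * \<delta>)\<^sup>2"
    by (simp add: power2_eq_square algebra_simps)
      (use \<delta> zero_le_square[of \<delta>] in linarith)
  then have p: "p \<le> 3 * \<delta>"
    using power2_le_imp_le[of "p - \<delta>" "2 * \<delta>"] \<delta> by simp
  have "norm (G x) = norm (r - \<epsilon> *\<^sub>R x)"
    by (simp add: r_def)
  also have "\<dots> \<le> norm r + p"
    using norm_triangle_ineq4[of r "\<epsilon> *\<^sub>R x"] \<epsilon>(1) by (simp add: p_def)
  also have "\<dots> < e"
    using x p by (simp add: r_def \<delta>_def)
  finally show ?thesis
    unfolding G_def by blast
qed

lemma asymptotically_regular_iff_small_displacement:
  "asymptotically_regular T \<longleftrightarrow>
    firmly_nonexpansive T \<and> (\<forall>e>0. \<exists>x. norm (x - T x) < e)"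
proof -
  have "(\<exists>x. (\<lambda>n::nat. x n - T (x n)) \<longlonglongrightarrow> 0) \<longleftrightarrow> (\<forall>e>0. \<exists>x. norm (x - T x) < e)"
  proof
    assume "\<exists>x. (\<lambda>n::nat. x n - T (x n)) \<longlonglongrightarrow> 0"
    then show "\<forall>e>0. \<exists>x. norm (x - T x) < e"
      by (fastforce simp: LIMSEQ_iff)
  next
    assume "\<forall>e>0. \<exists>x. norm (x - T x) < e"
    then have "\<forall>n. \<exists>x. norm (x - T x) < inverse (real (Suc n))"
      by simp
    then obtain x where "\<And>n. norm (x n - T (x n)) < inverse (real (Suc n))"
      by metis
    then have "(\<lambda>n. x n - T (x n)) \<longlonglongrightarrow> 0"
      by (intro Lim_null_comparison[OF _ LIMSEQ_inverse_real_of_nat] always_eventually)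
        (auto intro: less_imp_le)
    then show "\<exists>x. (\<lambda>n::nat. x n - T (x n)) \<longlonglongrightarrow> 0" by blast
  qed
  then show ?thesis
    by (simp add: asymptotically_regular_def)
qed

theorem theorem4p11:
  fixes m :: nat
    and T :: "nat \<Rightarrow> 'a::real_inner \<Rightarrow> 'a"
    and l :: "nat \<Rightarrow> real"
  assumes "finite_dimensional_space TYPE('a)"
    and "m \<ge> 1"
    and "\<And>i. i \<in> {1..m} \<Longrightarrow> firmly_nonexpansive (T i)"
    and "\<And>i. i \<in> {1..m} \<Longrightarrow> l i > 0"
    and "(\<Sum>i\<in>{1..m}. l i) = 1"
    and "\<And>i. i \<in> {1..m} \<Longrightarrow> asymptotically_regular (T i)"
  shows "asymptotically_regular (\<lambda>x. \<Sum>i\<in>{1..m}. l i *\<^sub>R T i x)"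
proof -
  have l: "0 \<le> l i" if "i \<in> {1..m}" for i
    using assms(4)[OF that] by simp
  have displacement: "(\<Sum>i\<in>{1..m}. l i *\<^sub>R (x - T i x)) = x - (\<Sum>i\<in>{1..m}. l i *\<^sub>R T i x)" for x
  proof -
    have "(\<Sum>i\<in>{1..m}. l i *\<^sub>R x) = x"
      by (simp only: assms(5) scaleR_one flip: scaleR_left.sum)
    then show ?thesis
      by (simp add: scaleR_diff_right sum_subtractf)
  qed
  have "\<exists>x. norm (\<Sum>i\<in>{1..m}. l i *\<^sub>R (x - T i x)) < e" if "0 < e" for e
  proof (rule convex_combination_small_values[OF _ l assms(5) _ that])
    show "firmly_nonexpansive (\<lambda>x. x - T i x)" if "i \<in> {1..m}" for i
      using assms(3)[OF that] by (rule firmly_nonexpansive_complement)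
    show "\<exists>y. norm (y - T i y) < d" if "i \<in> {1..m}" "0 < d" for i d
      using assms(6)[OF that(1)] that(2)
      by (simp add: asymptotically_regular_iff_small_displacement)
  qed
  moreover have "firmly_nonexpansive (\<lambda>x. \<Sum>i\<in>{1..m}. l i *\<^sub>R T i x)"
    using assms(3) l assms(5) by (rule firmly_nonexpansive_convex_combination)
  ultimately show ?thesis
    unfolding asymptotically_regular_iff_small_displacement displacement by blast
qed

end
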